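(* Let $R=\bigoplus_{n\in\mathbb{Z}}R_n$ be an arbitrary $\mathbb{Z}$-graded ring, let $I$ be a proper two-sided ideal of $R$, and let $A=R/I$ be equipped with the filtration $F_pA=(F_pR+I)/I$, $p\in\mathbb{Z}$, where $F_pR=\bigoplus_{i\le p}R_i$. Let $\phi: R\to G(A)$ be the natural graded epimorphism. Then $\operatorname{Ker}\phi=\langle \mathbf{LH}(I)\rangle$, and hence $G(A)\cong R/\langle\mathbf{LH}(I)\rangle$.
   Context: Rings are associative with unity $1$; graded ring homomorphisms are of degree $0$. The associated graded ring of $A$ is $G(A)=\bigoplus_{p\in\mathbb{Z}}G(A)_p$ with $G(A)_p=F_pA/F_{p-1}A$. There are canonical isomorphisms of abelian groups $$\frac{R_p\oplus F_{p-1}R}{(I\cap F_pR)+F_{p-1}R}=\frac{F_pR}{(I\cap F_pR)+F_{p-1}R}\ \xrightarrow{\ \cong\ }\ G(A)_p,\quad p\in\mathbb{Z}.$$ The natural maps $\phi_p:R_p\to \frac{R_p\oplus F_{p-1}R}{(I\cap F_pR)+F_{p-1}R}\cong G(A)_p$ are epimorphisms, and together they define the graded epimorphism $\phi:R\to G(A)$. For nonzero $f\in R$ written as $f=f_p+f_{p-1}+\cdots+f_{p-s}$ with $f_p\in R_p$, $f_{p-j}\in R_{p-j}$, $f_p\ne0$, the leading homogeneous part is $\mathbf{LH}(f)=f_p$ (and $\mathbf{LH}(0)=0$). For a subset $S\subseteq R$, $\mathbf{LH}(S)=\{\mathbf{LH}(f)\mid f\in S\}$, and $\langle\mathbf{LH}(S)\rangle$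 is the graded two-sided ideal of $R$ generated by $\mathbf{LH}(S)$. *)

theory Defs
  imports "HOL-Algebra.QuotRing" "HOL-Algebra.Product_Groups"
begin

locale graded_ring = ring R for R :: "('a, 'm) ring_scheme" (structure) +
  fixes \<G> :: "int \<Rightarrow> 'a set"
  assumes part_subgroup: "additive_subgroup (\<G> p) R"
    and decomposition: "x \<in> carrier R \<Longrightarrow>
      \<exists>!c. (\<forall>p. c p \<in> \<G> p) \<and> finite {p. c p \<noteq> \<zero>} \<and> x = (\<Oplus>p\<in>{p. c p \<noteq> \<zero>}. c p)"
    and mult_parts: "\<lbrakk>x \<in> \<G> p; y \<in> \<G> q\<rbrakk> \<Longrightarrow> x \<otimes> y \<in> \<G> (p + q)"

locale graded_ring_hom =
  source: graded_ring R \<G> + target: graded_ring S \<H>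
  for R :: "('a, 'm) ring_scheme" and \<G>
    and S :: "('b, 'n) ring_scheme" and \<H> +
  fixes f :: "'a \<Rightarrow> 'b"
  assumes ring_hom: "f \<in> ring_hom R S"
    and degree_zero: "f ` \<G> p \<subseteq> \<H> p"

locale graded_ring_epi = graded_ring_hom +
  assumes surjective: "f ` carrier R = carrier S"

locale graded_ring_iso = graded_ring_hom +
  assumes bijective: "bij_betw f (carrier R) (carrier S)"

definition graded_isomorphic ::
    "('a, 'm) ring_scheme \<Rightarrow> (int \<Rightarrow> 'a set) \<Rightarrow> ('b, 'n) ring_scheme \<Rightarrow> (int \<Rightarrow> 'b set) \<Rightarrow> bool"
  where "graded_isomorphic R \<G> S \<H> \<longleftrightarrow> (\<exists>f. graded_ring_iso R \<G> S \<H> f)"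


definition components :: "('a, 'm) ring_scheme \<Rightarrow> (int \<Rightarrow> 'a set) \<Rightarrow> 'a \<Rightarrow> int \<Rightarrow> 'a"
  where "components R \<G> x =
    (THE c. (\<forall>p. c p \<in> \<G> p) \<and> finite {p. c p \<noteq> \<zero>\<^bsub>R\<^esub>} \<and>
            x = (\<Oplus>\<^bsub>R\<^esub>p\<in>{p. c p \<noteq> \<zero>\<^bsub>R\<^esub>}. c p))"

definition LH :: "('a, 'm) ring_scheme \<Rightarrow> (int \<Rightarrow> 'a set) \<Rightarrow> 'a \<Rightarrow> 'a"
  where "LH R \<G> f =
    (if f = \<zero>\<^bsub>R\<^esub> then \<zero>\<^bsub>R\<^esub>
     else components R \<G> f (Max {p. components R \<G> f p \<noteq> \<zero>\<^bsub>R\<^esub>}))"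

definition grading_filtration :: "('a, 'm) ring_scheme \<Rightarrow> (int \<Rightarrow> 'a set) \<Rightarrow> int \<Rightarrow> 'a set"
  where "grading_filtration R \<G> p =
    {x \<in> carrier R. \<forall>i>p. components R \<G> x i = \<zero>\<^bsub>R\<^esub>}"

text \<open>The subset \<open>(S + I) / I\<close> of \<open>R / I\<close>, for an additive subgroup \<open>S\<close> of \<open>R\<close>.\<close>

definition quotient_part :: "('a, 'm) ring_scheme \<Rightarrow> 'a set \<Rightarrow> 'a set \<Rightarrow> 'a set set"
  where "quotient_part R I S = (\<lambda>x. I +>\<^bsub>R\<^esub> x) ` (S <+>\<^bsub>R\<^esub> I)"

definition quotient_filtration ::
    "('a, 'm) ring_scheme \<Rightarrow> (int \<Rightarrow> 'a set) \<Rightarrow> 'a set \<Rightarrow> int \<Rightarrow> 'a set set"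
  where "quotient_filtration R \<G> I p = quotient_part R I (grading_filtration R \<G> p)"


text \<open>
  \<open>F\<^sub>p A / F\<^sub>p\<^sub>-\<^sub>1 A\<close> for a ring \<open>A\<close> with filtration \<open>F\<close>.  As always with \<open>A_Mod\<close>, this additive
  group is a multiplicatively written monoid record whose neutral element is \<open>F (p - 1)\<close>.
\<close>

definition gr_part :: "('a, 'm) ring_scheme \<Rightarrow> (int \<Rightarrow> 'a set) \<Rightarrow> int \<Rightarrow> 'a set monoid"
  where "gr_part A F p = (A\<lparr>carrier := F p\<rparr>) A_Mod (F (p - 1))"

text \<open>
  Elements of the associated graded ring are the finitely supported families of cosets.  The
  coset product is \<open>(F\<^sub>p\<^sub>-\<^sub>1 A + a) (F\<^sub>q\<^sub>-\<^sub>1 A + b) = F\<^sub>p\<^sub>+\<^sub>q\<^sub>-\<^sub>1 A + ab\<close>, extended biadditively; \<open>finprod\<close>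
  is the finite sum in the additive group \<open>gr_part A F n\<close>.
\<close>

definition assoc_graded :: "('a, 'm) ring_scheme \<Rightarrow> (int \<Rightarrow> 'a set) \<Rightarrow> (int \<Rightarrow> 'a set) ring"
  where "assoc_graded A F =
    \<lparr>carrier = carrier (sum_group UNIV (gr_part A F)),
     mult = (\<lambda>g h n.
       finprod (gr_part A F n)
         (\<lambda>i. [mod F (n - 1):] g i \<Otimes>\<^bsub>A\<^esub> h (n - i))
         {i. g i \<noteq> \<one>\<^bsub>gr_part A F i\<^esub> \<and> h (n - i) \<noteq> \<one>\<^bsub>gr_part A F (n - i)\<^esub>}),
     one = (\<lambda>n. if n = 0 then F (- 1) +>\<^bsub>A\<^esub> \<one>\<^bsub>A\<^esub> else \<one>\<^bsub>gr_part A F n\<^esub>),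
     zero = \<one>\<^bsub>sum_group UNIV (gr_part A F)\<^esub>,
     add = monoid.mult (sum_group UNIV (gr_part A F))\<rparr>"

definition assoc_graded_part ::
    "('a, 'm) ring_scheme \<Rightarrow> (int \<Rightarrow> 'a set) \<Rightarrow> int \<Rightarrow> (int \<Rightarrow> 'a set) set"
  where "assoc_graded_part A F p =
    {g \<in> carrier (assoc_graded A F). \<forall>q. q \<noteq> p \<longrightarrow> g q = \<one>\<^bsub>gr_part A F q\<^esub>}"


text \<open>
  The canonical isomorphism \<open>F\<^sub>p R / ((I \<inter> F\<^sub>p R) + F\<^sub>p\<^sub>-\<^sub>1 R) \<rightarrow> G(A)\<^sub>p\<close> sends the class of \<open>f\<close> to the
  class of \<open>I + f\<close>.  The union is over equal cosets, as in \<^const>\<open>rcoset_mult\<close>: the value does not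
  depend on the representative \<open>f\<close> of \<open>C\<close>.
\<close>

definition canonical_part_map ::
    "('a, 'm) ring_scheme \<Rightarrow> (int \<Rightarrow> 'a set) \<Rightarrow> 'a set \<Rightarrow> int \<Rightarrow> 'a set \<Rightarrow> 'a set set"
  where "canonical_part_map R \<G> I p C =
    (\<Union>f\<in>C. quotient_filtration R \<G> I (p - 1) +>\<^bsub>R Quot I\<^esub> (I +>\<^bsub>R\<^esub> f))"

definition phi_part ::
    "('a, 'm) ring_scheme \<Rightarrow> (int \<Rightarrow> 'a set) \<Rightarrow> 'a set \<Rightarrow> int \<Rightarrow> 'a \<Rightarrow> 'a set set"
  where "phi_part R \<G> I p x =
    canonical_part_map R \<G> I p
      (((I \<inter> grading_filtration R \<G> p) <+>\<^bsub>R\<^esub> grading_filtration R \<G> (p - 1)) +>\<^bsub>R\<^esub> x)"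

definition phi ::
    "('a, 'm) ring_scheme \<Rightarrow> (int \<Rightarrow> 'a set) \<Rightarrow> 'a set \<Rightarrow> 'a \<Rightarrow> int \<Rightarrow> 'a set set"
  where "phi R \<G> I r = (\<lambda>p. phi_part R \<G> I p (components R \<G> r p))"

end

theory Submission
  imports Defs "HOL-Algebra.Multiplicative_Group"
begin

text \<open>
  With \<open>\<pi>\<close> the projection onto \<open>A = R / I\<close>, the \<open>p\<close>-th entry of \<open>\<phi> r\<close> is the class of \<open>\<pi> (r\<^sub>p)\<close> modulo \<open>F\<^sub>p\<^sub>-\<^sub>1 A\<close>.
  Hence \<open>\<phi>\<close> preserves all operations and is onto, so \<open>G(A)\<close> inherits the ring axioms, and also the
  grading, because the kernel of \<open>\<phi>\<close> is visibly homogeneous.  A homogeneous \<open>x\<close> of degree \<open>p\<close> is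
  killed iff \<open>x - y \<in> I\<close> for some \<open>y\<close> of degree less than \<open>p\<close>, i.e. iff \<open>x \<in> LH(I)\<close>; so the kernel is
  the ideal generated by \<open>LH(I)\<close>.  Finally, two graded images of \<open>R\<close> with the same kernel are isomorphic.
\<close>

section \<open>Calculus of homogeneous components\<close>

context graded_ring
begin

lemma part_carrier [simp, intro]: "x \<in> \<G> p \<Longrightarrow> x \<in> carrier R"
  using additive_subgroup.a_subset[OF part_subgroup] by blast

lemma part_zero [simp, intro]: "\<zero> \<in> \<G> p"
  using additive_subgroup.zero_closed[OF part_subgroup] .

lemma part_add: "x \<in> \<G> p \<Longrightarrow> y \<in> \<G> p \<Longrightarrow> x \<oplus> y \<in> \<G> p"
  using additive_subgroup.a_closed[OF part_subgroup] .

lemma finsum_neutral_right: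
  assumes "finite B" "A \<subseteq> B" "f \<in> A \<rightarrow> carrier R" "\<And>i. i \<in> B - A \<Longrightarrow> f i = \<zero>"
  shows "finsum R f A = finsum R f B"
  by (rule add.finprod_mono_neutral_cong_left) (use assms in auto)

lemma components_spec:
  assumes "x \<in> carrier R"
  shows "(\<forall>p. components R \<G> x p \<in> \<G> p) \<and> finite {p. components R \<G> x p \<noteq> \<zero>} \<and>
    x = (\<Oplus>p\<in>{p. components R \<G> x p \<noteq> \<zero>}. components R \<G> x p)"
  unfolding components_def by (rule theI'[OF decomposition[OF assms]])

lemma components_part [simp, intro]: "x \<in> carrier R \<Longrightarrow> components R \<G> x p \<in> \<G> p"
  using components_spec by blast

lemma components_carrier [simp, intro]: "x \<in> carrier R \<Longrightarrow> components R \<G> x p \<in> carrier R"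
  by (meson components_part part_carrier)

lemma finite_support: "x \<in> carrier R \<Longrightarrow> finite {p. components R \<G> x p \<noteq> \<zero>}"
  using components_spec by blast

lemma finsum_components:
  assumes "x \<in> carrier R" "finite B" "{p. components R \<G> x p \<noteq> \<zero>} \<subseteq> B"
  shows "(\<Oplus>p\<in>B. components R \<G> x p) = x"
proof -
  have "(\<Oplus>p\<in>{p. components R \<G> x p \<noteq> \<zero>}. components R \<G> x p) = (\<Oplus>p\<in>B. components R \<G> x p)"
    by (rule finsum_neutral_right) (use assms in auto)
  then show ?thesis
    using components_spec[OF assms(1)] by simp
qed

text \<open>Zero summands drop out, so the index set \<open>B\<close> may exceed the support of
  \<open>c\<close>; the uniqueness in \<open>decomposition\<close> then identifies the family. All
  later computations of components rest on this.\<close>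

lemma components_eqI:
  assumes "finite B" "\<And>p. c p \<in> \<G> p" "\<And>p. p \<notin> B \<Longrightarrow> c p = \<zero>" "x = (\<Oplus>p\<in>B. c p)"
  shows "components R \<G> x = c"
proof -
  have supp: "{p. c p \<noteq> \<zero>} \<subseteq> B"
    using assms(3) by blast
  have "(\<Oplus>p\<in>{p. c p \<noteq> \<zero>}. c p) = (\<Oplus>p\<in>B. c p)"
    by (rule finsum_neutral_right) (use assms(1,2) supp in auto)
  with assms supp have "(\<forall>p. c p \<in> \<G> p) \<and> finite {p. c p \<noteq> \<zero>} \<and> x = (\<Oplus>p\<in>{p. c p \<noteq> \<zero>}. c p)"
    by (auto intro: finite_subset)
  moreover have "x \<in> carrier R"
    using assms by (auto intro!: finsum_closed)
  ultimately show ?thesis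
    using decomposition[of x] components_spec[of x] by blast
qed

lemma components_homogeneous:
  assumes "x \<in> \<G> p"
  shows "components R \<G> x = (\<lambda>q. if q = p then x else \<zero>)"
  by (rule components_eqI[where B = "{p}"]) (use assms in auto)

lemma components_zero: "components R \<G> \<zero> p = \<zero>"
  using components_homogeneous[OF part_zero[of p]] by simp

lemma components_add:
  assumes "x \<in> carrier R" "y \<in> carrier R"
  shows "components R \<G> (x \<oplus> y) p = components R \<G> x p \<oplus> components R \<G> y p"
proof -
  let ?B = "{p. components R \<G> x p \<noteq> \<zero>} \<union> {p. components R \<G> y p \<noteq> \<zero>}"
  have "components R \<G> (x \<oplus> y) = (\<lambda>p. components R \<G> x p \<oplus> components R \<G> y p)"
  proof (rule components_eqI[where B = ?B])
    show "finite ?B"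
      using assms finite_support by blast
    then show "x \<oplus> y = (\<Oplus>p\<in>?B. components R \<G> x p \<oplus> components R \<G> y p)"
      using assms by (subst finsum_addf) (auto simp: finsum_components)
  qed (use assms in \<open>auto intro: part_add\<close>)
  then show ?thesis
    by simp
qed

lemma components_uminus:
  assumes "x \<in> carrier R"
  shows "components R \<G> (\<ominus> x) p = \<ominus> components R \<G> x p"
proof -
  have "components R \<G> (\<ominus> x) p \<oplus> components R \<G> x p = \<zero>"
    using components_add[of "\<ominus> x" x p] assms by (simp add: l_neg components_zero)
  then show ?thesis
    using assms by (simp add: minus_equality)
qed

lemma components_minus:
  assumes "x \<in> carrier R" "y \<in> carrier R"
  shows "components R \<G> (x \<ominus> y) p = components R \<G> x p \<ominus> components R \<G> y p"
  using assms by (simp add: a_minus_def components_add components_uminus)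

lemma components_finsum:
  assumes "finite B" "f \<in> B \<rightarrow> carrier R"
  shows "components R \<G> (\<Oplus>i\<in>B. f i) n = (\<Oplus>i\<in>B. components R \<G> (f i) n)"
  using assms
proof (induction B rule: finite_induct)
  case empty
  then show ?case by (simp add: components_zero)
next
  case (insert i B)
  then show ?case
    by (subst finsum_insert, simp_all) (subst finsum_insert, auto simp: components_add Pi_iff)
qed

text \<open>Multiplying the decomposition of \<open>y\<close> termwise by \<open>x\<close> raises
  each degree by \<open>p\<close>; the support of the product is contained in the translate of that
  of \<open>y\<close>.\<close>

lemma components_homogeneous_mult:
  assumes x: "x \<in> \<G> p" and y: "y \<in> carrier R"
  shows "components R \<G> (x \<otimes> y) n = x \<otimes> components R \<G> y (n - p)"
proof -
  let ?B = "{q. components R \<G> y q \<noteq> \<zero>}"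
  have "components R \<G> (x \<otimes> y) = (\<lambda>n. x \<otimes> components R \<G> y (n - p))"
  proof (rule components_eqI[where B = "(\<lambda>q. q + p) ` ?B"])
    show "finite ((\<lambda>q. q + p) ` ?B)"
      using y finite_support by blast
    show "x \<otimes> components R \<G> y (n - p) \<in> \<G> n" for n
      using mult_parts[OF x components_part[OF y, of "n - p"]] by simp
    show "x \<otimes> components R \<G> y (n - p) = \<zero>" if "n \<notin> (\<lambda>q. q + p) ` ?B" for n
    proof -
      have "components R \<G> y (n - p) = \<zero>"
        using that by (auto simp: image_iff)
      then show ?thesis using x by simp
    qed
    have "x \<otimes> y = x \<otimes> (\<Oplus>q\<in>?B. components R \<G> y q)"
      using finsum_components[OF y finite_support[OF y]] by simp
    also have "\<dots> = (\<Oplus>q\<in>?B. x \<otimes> components R \<G> y q)"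
      using x y by (intro finsum_rdistr finite_support) auto
    also have "\<dots> = (\<Oplus>n\<in>(\<lambda>q. q + p) ` ?B. x \<otimes> components R \<G> y (n - p))"
      using x y by (subst finsum_reindex) (auto simp: inj_on_def)
    finally show "x \<otimes> y = (\<Oplus>n\<in>(\<lambda>q. q + p) ` ?B. x \<otimes> components R \<G> y (n - p))" .
  qed
  then show ?thesis
    by simp
qed

text \<open>Only \<open>x\<close> is expanded, and the homogeneous case is applied to each summand.
  The set \<open>B\<close> is left free, so that one sum can serve all degrees \<open>n\<close> and
  extra indices can be inserted.\<close>

lemma components_mult:
  assumes x: "x \<in> carrier R" and y: "y \<in> carrier R"
    and B: "finite B" "{i. components R \<G> x i \<noteq> \<zero>} \<subseteq> B"
  shows "components R \<G> (x \<otimes> y) n = (\<Oplus>i\<in>B. components R \<G> x i \<otimes> components R \<G> y (n - i))"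
proof -
  have "x \<otimes> y = (\<Oplus>i\<in>B. components R \<G> x i) \<otimes> y"
    using finsum_components[OF x B] by simp
  also have "\<dots> = (\<Oplus>i\<in>B. components R \<G> x i \<otimes> y)"
    using x y by (intro finsum_ldistr B) auto
  finally have "components R \<G> (x \<otimes> y) n = (\<Oplus>i\<in>B. components R \<G> (components R \<G> x i \<otimes> y) n)"
    using x y B by (simp add: components_finsum)
  also have "\<dots> = (\<Oplus>i\<in>B. components R \<G> x i \<otimes> components R \<G> y (n - i))"
    by (rule finsum_cong') (use x y in \<open>auto simp: components_homogeneous_mult[OF components_part]\<close>)
  finally show ?thesis .
qed

text \<open>The degree zero component \<open>e\<close> of the unit is a left identity for
  homogeneous elements, as a comparison of degrees in \<open>\<one> \<otimes> y = y\<close> shows.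
  In particular it fixes every component of the unit, whence
  \<open>e = e \<otimes> \<one> = \<one>\<close>.\<close>

lemma one_part: "\<one> \<in> \<G> 0"
proof -
  define e where "e = components R \<G> \<one> 0"
  have e: "e \<in> \<G> 0"
    unfolding e_def by auto
  have e_id: "e \<otimes> y = y" if y: "y \<in> \<G> p" for y p
  proof -
    \<comment> \<open>The index 0 is inserted because it is not known in advance that
      \<open>e\<close> is nonzero.\<close>
    let ?B = "insert 0 {i. components R \<G> \<one> i \<noteq> \<zero>}"
    have fin: "finite ?B"
      using finite_support[OF one_closed] by simp
    have "y = components R \<G> (\<one> \<otimes> y) p"
      using y by (simp add: components_homogeneous[OF y])
    also have "\<dots> = (\<Oplus>i\<in>?B. components R \<G> \<one> i \<otimes> components R \<G> y (p - i))"
      using y fin by (intro components_mult) auto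
    \<comment> \<open>Since \<open>y\<close> has no component outside degree \<open>p\<close>, only
      \<open>i = 0\<close> survives.\<close>
    also have "\<dots> = (\<Oplus>i\<in>?B. if 0 = i then e \<otimes> y else \<zero>)"
      by (rule finsum_cong') (use y e in \<open>auto simp: components_homogeneous[OF y] e_def\<close>)
    also have "\<dots> = e \<otimes> y"
      using finsum_singleton[OF _ fin, of 0 "\<lambda>_. e \<otimes> y"] y e by auto
    finally show ?thesis by simp
  qed
  let ?B = "{i. components R \<G> \<one> i \<noteq> \<zero>}"
  have "e = e \<otimes> (\<Oplus>i\<in>?B. components R \<G> \<one> i)"
    using e by (simp add: finsum_components finite_support)
  also have "\<dots> = (\<Oplus>i\<in>?B. e \<otimes> components R \<G> \<one> i)"
    using e by (intro finsum_rdistr finite_support) auto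
  also have "\<dots> = (\<Oplus>i\<in>?B. components R \<G> \<one> i)"
    by (rule finsum_cong') (auto intro: e_id)
  also have "\<dots> = \<one>"
    by (simp add: finsum_components finite_support)
  finally show ?thesis using e by simp
qed

section \<open>The degree filtration and leading homogeneous parts\<close>

lemma filtration_subgroup: "additive_subgroup (grading_filtration R \<G> p) R"
proof (rule additive_subgroupI, rule add.subgroupI)
  show "grading_filtration R \<G> p \<noteq> {}"
    using components_zero by (auto simp: grading_filtration_def)
qed (auto simp: grading_filtration_def components_uminus components_add a_inv_def[symmetric])

lemma filtration_carrier: "x \<in> grading_filtration R \<G> p \<Longrightarrow> x \<in> carrier R"
  by (simp add: grading_filtration_def)

lemma filtration_mono: "p \<le> q \<Longrightarrow> grading_filtration R \<G> p \<subseteq> grading_filtration R \<G> q"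
  by (auto simp: grading_filtration_def)

lemma part_filtration: "x \<in> \<G> p \<Longrightarrow> x \<in> grading_filtration R \<G> p"
  by (auto simp: grading_filtration_def components_homogeneous)

text \<open>In a degree \<open>n > p + q\<close> every term of the convolution has
  \<open>i > p\<close> or \<open>n - i > q\<close>, so one of its factors vanishes.\<close>

lemma filtration_mult:
  assumes "x \<in> grading_filtration R \<G> p" "y \<in> grading_filtration R \<G> q"
  shows "x \<otimes> y \<in> grading_filtration R \<G> (p + q)"
proof -
  have x: "x \<in> carrier R" and y: "y \<in> carrier R"
    using assms filtration_carrier by auto
  have "components R \<G> (x \<otimes> y) n = \<zero>" if "n > p + q" for n
  proof -
    have "components R \<G> x i \<otimes> components R \<G> y (n - i) = \<zero>" for i
      using assms that x y by (cases "i > p") (auto simp: grading_filtration_def)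
    then show ?thesis
      using components_mult[OF x y finite_support[OF x] order.refl] by simp
  qed
  then show ?thesis
    using x y by (simp add: grading_filtration_def)
qed

text \<open>This is the splitting \<open>F_p R = R_p + F_(p-1) R\<close>: modulo the lower step, an
  element of filtration degree \<open>p\<close> may be replaced by a homogeneous one.\<close>

lemma minus_top_component:
  assumes "x \<in> grading_filtration R \<G> p"
  shows "x \<ominus> components R \<G> x p \<in> grading_filtration R \<G> (p - 1)"
proof -
  have x: "x \<in> carrier R"
    using assms filtration_carrier by auto
  have "components R \<G> (x \<ominus> components R \<G> x p) n = \<zero>" if "n > p - 1" for n
    using that assms x components_homogeneous[OF components_part[OF x], of p]
    by (cases "n = p") (auto simp: components_add components_uminus grading_filtration_def a_minus_def r_neg)
  then show ?thesis
    using x by (simp add: grading_filtration_def)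
qed

text \<open>The two conditions say that \<open>p\<close> is the maximum of the support, which
  removes \<open>Max\<close> from later arguments; \<open>top_degree\<close> supplies such a
  \<open>p\<close> for each nonzero element.\<close>

lemma LH_eqI:
  assumes x: "x \<in> grading_filtration R \<G> p" and nz: "components R \<G> x p \<noteq> \<zero>"
  shows "LH R \<G> x = components R \<G> x p"
proof -
  have "Max {q. components R \<G> x q \<noteq> \<zero>} = p"
  proof (rule Max_eqI)
    show "finite {q. components R \<G> x q \<noteq> \<zero>}"
      using x filtration_carrier finite_support by blast
    show "q \<le> p" if "q \<in> {q. components R \<G> x q \<noteq> \<zero>}" for q
      using that x by (force simp: grading_filtration_def not_less[symmetric])
  qed (use nz in simp)
  then show ?thesis
    using nz by (auto simp: LH_def components_zero)
qed

lemma top_degree: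
  assumes x: "x \<in> carrier R" and nz: "x \<noteq> \<zero>"
  obtains p where "x \<in> grading_filtration R \<G> p" "components R \<G> x p \<noteq> \<zero>"
proof -
  let ?S = "{q. components R \<G> x q \<noteq> \<zero>}"
  have fin: "finite ?S"
    using x finite_support by blast
  have "?S \<noteq> {}"
  proof
    assume "?S = {}"
    then show False
      using finsum_components[OF x fin order.refl] nz by simp
  qed
  then have "Max ?S \<in> ?S"
    using fin Max_in by blast
  moreover have "x \<in> grading_filtration R \<G> (Max ?S)"
    using x Max_ge[OF fin] by (force simp: grading_filtration_def)
  ultimately show ?thesis
    using that by blast
qed

lemma LH_homogeneous: "x \<in> carrier R \<Longrightarrow> \<exists>p. LH R \<G> x \<in> \<G> p"
  unfolding LH_def using components_part part_zero by metis

lemma LH_carrier: "x \<in> carrier R \<Longrightarrow> LH R \<G> x \<in> carrier R"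
  using LH_homogeneous part_carrier by blast

end

section \<open>Gradings carried along surjective homomorphisms, and graded images with equal
  kernels\<close>

lemma graded_ring_epi_image:
  assumes "graded_ring R \<G>" and "ring S" and hom: "f \<in> ring_hom R S"
    and surj: "f ` carrier R = carrier S"
    and homogeneous: "\<And>x p. \<lbrakk>x \<in> carrier R; f x = \<zero>\<^bsub>S\<^esub>\<rbrakk> \<Longrightarrow> f (components R \<G> x p) = \<zero>\<^bsub>S\<^esub>"
    and parts: "\<And>p. \<H> p = f ` \<G> p"
  shows "graded_ring_epi R \<G> S \<H> f"
proof -
  interpret R: graded_ring R \<G> by fact
  interpret S: ring S by fact
  interpret f: ring_hom_ring R S f
    by (rule ring_hom_ringI2) (use hom R.ring_axioms S.ring_axioms in auto)
  \<comment> \<open>Decompositions exist in \<open>S\<close> because they can be pushed forward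
    along the surjection \<open>f\<close>. They are unique because the kernel contains the
    components of each of its elements.\<close>
  have "graded_ring S \<H>"
  proof (intro graded_ring.intro graded_ring_axioms.intro)
    show "ring S" by fact
    show "additive_subgroup (\<H> p) S" for p
    proof (rule additive_subgroupI)
      show "subgroup (\<H> p) (add_monoid S)"
        unfolding parts
        by (rule group_hom.subgroup_img_is_subgroup[OF f.a_group_hom additive_subgroup.a_subgroup])
          (rule R.part_subgroup)
    qed
    show "x \<otimes>\<^bsub>S\<^esub> y \<in> \<H> (p + q)" if "x \<in> \<H> p" "y \<in> \<H> q" for x y p q
      using that R.mult_parts unfolding parts
      by (auto simp flip: f.hom_mult)
    have lift: "\<exists>x\<in>carrier R. y = f x \<and> (\<forall>p. c p = f (components R \<G> x p))"
      if c: "\<And>p. c p \<in> \<H> p" and fin: "finite {p. c p \<noteq> \<zero>\<^bsub>S\<^esub>}"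
        and y: "y = (\<Oplus>\<^bsub>S\<^esub>p\<in>{p. c p \<noteq> \<zero>\<^bsub>S\<^esub>}. c p)" for y c
    proof -
      \<comment> \<open>Zero entries are lifted to zero: arbitrary lifts from the kernel could give
        a family with infinite support, which is the component family of no element.\<close>
      have "\<forall>p. \<exists>a\<in>\<G> p. c p = f a \<and> (c p = \<zero>\<^bsub>S\<^esub> \<longrightarrow> a = \<zero>\<^bsub>R\<^esub>)"
      proof
        fix p
        show "\<exists>a\<in>\<G> p. c p = f a \<and> (c p = \<zero>\<^bsub>S\<^esub> \<longrightarrow> a = \<zero>\<^bsub>R\<^esub>)"
          using c[of p] unfolding parts by (cases "c p = \<zero>\<^bsub>S\<^esub>") (auto intro: bexI[of _ "\<zero>\<^bsub>R\<^esub>"])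
      qed
      then obtain a where a: "\<And>p. a p \<in> \<G> p" "\<And>p. c p = f (a p)"
        "\<And>p. c p = \<zero>\<^bsub>S\<^esub> \<Longrightarrow> a p = \<zero>\<^bsub>R\<^esub>"
        by metis
      define x where "x = finsum R a {p. c p \<noteq> \<zero>\<^bsub>S\<^esub>}"
      have x: "x \<in> carrier R"
        unfolding x_def using a(1) by (intro R.finsum_closed) auto
      have "components R \<G> x = a"
        by (rule R.components_eqI[OF fin a(1) _ x_def]) (use a(3) in auto)
      moreover have "f x = y"
        unfolding x_def y using R.part_carrier[OF a(1)] by (simp add: Pi_iff comp_def flip: a(2))
      ultimately show ?thesis
        using x a(2) by auto
    qed
    show "\<exists>!c. (\<forall>p. c p \<in> \<H> p) \<and> finite {p. c p \<noteq> \<zero>\<^bsub>S\<^esub>} \<and>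
        y = (\<Oplus>\<^bsub>S\<^esub>p\<in>{p. c p \<noteq> \<zero>\<^bsub>S\<^esub>}. c p)" if "y \<in> carrier S" for y
    proof (rule ex_ex1I)
      from that have "y \<in> f ` carrier R"
        by (simp add: surj)
      then obtain x where x: "x \<in> carrier R" "y = f x"
        by blast
      let ?c = "\<lambda>p. f (components R \<G> x p)" and ?B = "{p. components R \<G> x p \<noteq> \<zero>\<^bsub>R\<^esub>}"
      \<comment> \<open>Nonzero components may be killed by \<open>f\<close>, so the support can
        shrink; the sum over \<open>?B\<close> must be cut down to the support of
        \<open>?c\<close>.\<close>
      have sub: "{p. ?c p \<noteq> \<zero>\<^bsub>S\<^esub>} \<subseteq> ?B"
        by auto
      have fin: "finite ?B"
        using R.finite_support[OF x(1)] .
      have "y = f (\<Oplus>\<^bsub>R\<^esub>p\<in>?B. components R \<G> x p)"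
        using x R.finsum_components[OF x(1) fin order.refl] by simp
      also have "\<dots> = (\<Oplus>\<^bsub>S\<^esub>p\<in>?B. ?c p)"
        using x by (subst f.hom_finsum) (auto simp: comp_def)
      also have "\<dots> = (\<Oplus>\<^bsub>S\<^esub>p\<in>{p. ?c p \<noteq> \<zero>\<^bsub>S\<^esub>}. ?c p)"
        by (rule S.add.finprod_mono_neutral_cong_right) (use fin x in auto)
      finally show "\<exists>c. (\<forall>p. c p \<in> \<H> p) \<and> finite {p. c p \<noteq> \<zero>\<^bsub>S\<^esub>} \<and>
          y = (\<Oplus>\<^bsub>S\<^esub>p\<in>{p. c p \<noteq> \<zero>\<^bsub>S\<^esub>}. c p)"
        using x fin sub by (intro exI[of _ ?c]) (auto simp: parts intro: finite_subset)
    next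
      fix c d
      assume "(\<forall>p. c p \<in> \<H> p) \<and> finite {p. c p \<noteq> \<zero>\<^bsub>S\<^esub>} \<and> y = (\<Oplus>\<^bsub>S\<^esub>p\<in>{p. c p \<noteq> \<zero>\<^bsub>S\<^esub>}. c p)"
        and "(\<forall>p. d p \<in> \<H> p) \<and> finite {p. d p \<noteq> \<zero>\<^bsub>S\<^esub>} \<and> y = (\<Oplus>\<^bsub>S\<^esub>p\<in>{p. d p \<noteq> \<zero>\<^bsub>S\<^esub>}. d p)"
      then have "\<exists>u\<in>carrier R. y = f u \<and> (\<forall>p. c p = f (components R \<G> u p))"
        "\<exists>v\<in>carrier R. y = f v \<and> (\<forall>p. d p = f (components R \<G> v p))"
        by (metis (lifting) lift)+
      then obtain u v where u: "u \<in> carrier R" "y = f u" "\<And>p. c p = f (components R \<G> u p)"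
        and v: "v \<in> carrier R" "y = f v" "\<And>p. d p = f (components R \<G> v p)"
        by blast
      \<comment> \<open>The lifts \<open>u\<close> and \<open>v\<close> of the two decompositions
        have the same image \<open>y\<close>. Their difference lies in the kernel, hence so do its
        components, and these map to \<open>c p - d p\<close>.\<close>
      have "f (u \<ominus>\<^bsub>R\<^esub> v) = \<zero>\<^bsub>S\<^esub>"
        using u v by (simp add: R.minus_eq S.r_neg flip: u(2))
      then have "f (components R \<G> u p \<ominus>\<^bsub>R\<^esub> components R \<G> v p) = \<zero>\<^bsub>S\<^esub>" for p
        using homogeneous[of "u \<ominus>\<^bsub>R\<^esub> v" p] u v by (simp add: R.components_minus)
      then have "c p \<ominus>\<^bsub>S\<^esub> d p = \<zero>\<^bsub>S\<^esub>" for p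
        using u v by (simp add: R.minus_eq S.minus_eq)
      then show "c = d"
        using u v by (intro ext) (simp add: S.r_right_minus_eq)
    qed
  qed
  then show ?thesis
    using assms unfolding graded_ring_epi_def graded_ring_hom_def graded_ring_hom_axioms_def
      graded_ring_epi_axioms_def by simp
qed

text \<open>Both \<open>f\<close> and \<open>g\<close> identify two elements of \<open>R\<close>
  exactly when their difference lies in the common kernel, so \<open>f x \<mapsto> g x\<close> is
  well defined and injective. It has degree zero because each \<open>\<H> p\<close> consists of
  images of elements of \<open>\<G> p\<close>.\<close>

lemma graded_isomorphic_if_same_kernel:
  assumes f: "graded_ring_epi R \<G> S \<H> f" and g: "graded_ring_epi R \<G> T \<K> g"
    and parts: "\<And>p. \<H> p = f ` \<G> p"
    and kernel: "a_kernel R S f = a_kernel R T g"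
  shows "graded_isomorphic S \<H> T \<K>"
proof -
  interpret f: graded_ring_epi R \<G> S \<H> f by fact
  interpret g: graded_ring_epi R \<G> T \<K> g by fact
  interpret fr: ring_hom_ring R S f
    by (rule ring_hom_ringI2)
      (use f.ring_hom f.source.ring_axioms f.target.ring_axioms in auto)
  interpret gr: ring_hom_ring R T g
    by (rule ring_hom_ringI2)
      (use g.ring_hom f.source.ring_axioms g.target.ring_axioms in auto)
  have eq_iff: "f x = f y \<longleftrightarrow> g x = g y" if "x \<in> carrier R" "y \<in> carrier R" for x y
  proof -
    have "f x = f y \<longleftrightarrow> f (x \<ominus>\<^bsub>R\<^esub> y) = \<zero>\<^bsub>S\<^esub>"
      using that f.target.r_right_minus_eq[of "f x" "f y"]
      by (simp add: f.source.minus_eq f.target.minus_eq)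
    also have "\<dots> \<longleftrightarrow> g (x \<ominus>\<^bsub>R\<^esub> y) = \<zero>\<^bsub>T\<^esub>"
      using that kernel unfolding a_kernel_def' by blast
    also have "\<dots> \<longleftrightarrow> g x = g y"
      using that g.target.r_right_minus_eq[of "g x" "g y"]
      by (simp add: f.source.minus_eq g.target.minus_eq)
    finally show ?thesis .
  qed
  \<comment> \<open>The preimage is chosen arbitrarily; by \<open>eq_iff\<close> the choice does not
    affect the value.\<close>
  define h where "h s = g (inv_into (carrier R) f s)" for s
  have h: "h (f x) = g x" if "x \<in> carrier R" for x
    using that eq_iff[of "inv_into (carrier R) f (f x)" x]
    by (simp add: h_def inv_into_into f_inv_into_f)
  have lift: "\<exists>x\<in>carrier R. s = f x" if "s \<in> carrier S" for s
    using that f.surjective by blast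
  have "h \<in> ring_hom S T"
  proof (rule ring_hom_memI)
    show "h \<one>\<^bsub>S\<^esub> = \<one>\<^bsub>T\<^esub>"
      using h[of "\<one>\<^bsub>R\<^esub>"] by simp
    fix s t assume "s \<in> carrier S" "t \<in> carrier S"
    then obtain x y where xy: "x \<in> carrier R" "s = f x" "y \<in> carrier R" "t = f y"
      using lift by metis
    show "h s \<in> carrier T"
      using xy by (simp add: h)
    show "h (s \<otimes>\<^bsub>S\<^esub> t) = h s \<otimes>\<^bsub>T\<^esub> h t"
      using xy h[of "x \<otimes>\<^bsub>R\<^esub> y"] by (simp add: h)
    show "h (s \<oplus>\<^bsub>S\<^esub> t) = h s \<oplus>\<^bsub>T\<^esub> h t"
      using xy h[of "x \<oplus>\<^bsub>R\<^esub> y"] by (simp add: h)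
  qed
  moreover have "h ` \<H> p \<subseteq> \<K> p" for p
    using g.degree_zero[of p] by (auto simp: parts h)
  moreover have "bij_betw h (carrier S) (carrier T)"
  proof (rule bij_betw_imageI)
    show "inj_on h (carrier S)"
      unfolding f.surjective[symmetric] by (auto simp: inj_on_def h eq_iff)
    show "h ` carrier S = carrier T"
      unfolding f.surjective[symmetric] g.surjective[symmetric] by (force simp: h image_image)
  qed
  ultimately have "graded_ring_iso S \<H> T \<K> h"
    by (simp add: graded_ring_iso_def graded_ring_hom_def graded_ring_hom_axioms_def
        graded_ring_iso_axioms_def f.target.graded_ring_axioms g.target.graded_ring_axioms)
  then show ?thesis
    unfolding graded_isomorphic_def by blast
qed


section \<open>The associated graded ring of a filtered ring, computed on representatives\<close>

locale multiplicative_filtration = ring A for A :: "('a, 'm) ring_scheme" (structure) +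
  fixes F :: "int \<Rightarrow> 'a set"
  assumes subgroup_F: "additive_subgroup (F p) A"
    and mono_F: "p \<le> q \<Longrightarrow> F p \<subseteq> F q"
    and mult_F: "\<lbrakk>x \<in> F p; y \<in> F q\<rbrakk> \<Longrightarrow> x \<otimes> y \<in> F (p + q)"
begin

lemma F_carrier: "x \<in> F p \<Longrightarrow> x \<in> carrier A"
  using additive_subgroup.a_subset[OF subgroup_F] by blast

lemma F_zero: "\<zero> \<in> F p"
  using additive_subgroup.zero_closed[OF subgroup_F] .

lemma F_add: "x \<in> F p \<Longrightarrow> y \<in> F p \<Longrightarrow> x \<oplus> y \<in> F p"
  using additive_subgroup.a_closed[OF subgroup_F] .

lemma abelian_subgroup_F: "abelian_subgroup (F p) A"
  by (rule abelian_subgroupI3[OF subgroup_F]) (rule abelian_group_axioms)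

lemma coset_sum:
  "x \<in> carrier A \<Longrightarrow> y \<in> carrier A \<Longrightarrow> (F p +> x) <+> (F p +> y) = F p +> (x \<oplus> y)"
  using abelian_subgroup.a_rcos_sum[OF abelian_subgroup_F] .

lemma coset_zero_iff: "x \<in> carrier A \<Longrightarrow> F p +> x = F p \<longleftrightarrow> x \<in> F p"
  using a_coset_join1 a_coset_join2 additive_subgroup.a_subset additive_subgroup.a_subgroup subgroup_F
  by metis

lemma coset_shift: "x \<in> F p \<Longrightarrow> y \<in> carrier A \<Longrightarrow> F p +> (x \<oplus> y) = F p +> y"
  using additive_subgroup.a_subset[OF subgroup_F] coset_zero_iff[of x p]
  by (simp add: a_coset_add_assoc[symmetric] F_carrier)

lemma carrier_gr_part: "carrier (gr_part A F p) = (\<lambda>x. F (p - 1) +> x) ` F p"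
  by (auto simp: gr_part_def A_FactGroup_def FactGroup_def RCOSETS_def a_r_coset_def r_coset_def)

lemma one_gr_part: "\<one>\<^bsub>gr_part A F p\<^esub> = F (p - 1)"
  by (simp add: gr_part_def A_FactGroup_def FactGroup_def)

lemma mult_gr_part: "(\<otimes>\<^bsub>gr_part A F p\<^esub>) = set_add A"
  by (simp add: gr_part_def A_FactGroup_def FactGroup_def set_add_def set_mult_def fun_eq_iff)

lemma comm_group_gr_part: "comm_group (gr_part A F p)"
proof -
  let ?G = "(add_monoid A)\<lparr>carrier := F p\<rparr>"
  have "group ?G"
    using add.subgroup_imp_group[OF additive_subgroup.a_subgroup[OF subgroup_F]] .
  then interpret G: comm_group ?G
    by (rule group.group_comm_groupI) (auto simp: F_carrier a_comm)
  have "subgroup (F (p - 1)) ?G"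
    using add.subgroup_incl[OF additive_subgroup.a_subgroup[OF subgroup_F]
        additive_subgroup.a_subgroup[OF subgroup_F] mono_F[of "p - 1" p]] by simp
  from G.abelian_FactGroup[OF this] show ?thesis
    by (simp add: gr_part_def A_FactGroup_def)
qed

lemma group_gr_part: "group (gr_part A F p)"
  using comm_group_gr_part by (rule comm_group.axioms)

text \<open>Taking cosets is additive, and \<open>finprod\<close> is the sum of the quotient group,
  which is written multiplicatively. This moves the sum in the product of
  \<open>assoc_graded\<close> inside a single coset.\<close>

lemma finprod_gr_part:
  assumes "finite B" "\<And>i. i \<in> B \<Longrightarrow> a i \<in> F p"
  shows "finprod (gr_part A F p) (\<lambda>i. F (p - 1) +> a i) B = F (p - 1) +> (\<Oplus>i\<in>B. a i)"
proof -
  interpret G: comm_group "gr_part A F p"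
    by (rule comm_group_gr_part)
  show ?thesis
    using assms
  proof (induction B rule: finite_induct)
    case empty
    then show ?case
      using coset_zero_iff[of \<zero>] by (simp add: one_gr_part F_zero)
  next
    case (insert i B)
    have a: "a \<in> insert i B \<rightarrow> carrier A"
      using insert.prems F_carrier by blast
    have "finprod (gr_part A F p) (\<lambda>i. F (p - 1) +> a i) (insert i B) =
        (F (p - 1) +> a i) \<otimes>\<^bsub>gr_part A F p\<^esub> finprod (gr_part A F p) (\<lambda>i. F (p - 1) +> a i) B"
      using insert by (intro G.finprod_insert) (auto simp: carrier_gr_part)
    also have "\<dots> = F (p - 1) +> (a i \<oplus> (\<Oplus>i\<in>B. a i))"
      using insert a by (simp add: mult_gr_part coset_sum Pi_iff)
    also have "a i \<oplus> (\<Oplus>i\<in>B. a i) = (\<Oplus>i\<in>insert i B. a i)"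
      using insert a by (intro finsum_insert[symmetric]) auto
    finally show ?case .
  qed
qed

text \<open>Changing \<open>x\<close> by \<open>u \<in> F (p - 1)\<close> and \<open>y\<close> by
  \<open>v \<in> F (q - 1)\<close> changes the product by
  \<open>u \<otimes> (v \<oplus> y) \<oplus> x \<otimes> v\<close>, which lies in
  \<open>F (p + q - 1)\<close>. So the union defining \<open>rcoset_mult\<close> runs over equal
  cosets.\<close>

lemma rcoset_mult_F:
  assumes x: "x \<in> F p" and y: "y \<in> F q"
  shows "[mod F (p + q - 1):] (F (p - 1) +> x) \<Otimes> (F (q - 1) +> y) = F (p + q - 1) +> (x \<otimes> y)"
proof -
  have xy: "x \<in> carrier A" "y \<in> carrier A"
    using x y F_carrier by auto
  have same: "F (p + q - 1) +> ((u \<oplus> x) \<otimes> (v \<oplus> y)) = F (p + q - 1) +> (x \<otimes> y)"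
    if u: "u \<in> F (p - 1)" and v: "v \<in> F (q - 1)" for u v
  proof -
    have "v \<oplus> y \<in> F q"
      using v y mono_F[of "q - 1" q] by (intro F_add) auto
    then have "u \<otimes> (v \<oplus> y) \<oplus> x \<otimes> v \<in> F (p + q - 1)"
      using mult_F[OF u, of "v \<oplus> y" q] mult_F[OF x v] by (intro F_add) (simp_all add: algebra_simps)
    moreover have "(u \<oplus> x) \<otimes> (v \<oplus> y) = (u \<otimes> (v \<oplus> y) \<oplus> x \<otimes> v) \<oplus> x \<otimes> y"
      using u v xy by (simp add: F_carrier l_distr r_distr a_ac)
    ultimately show ?thesis
      using xy by (simp add: coset_shift)
  qed
  have coset: "F k +> z = (\<lambda>u. u \<oplus> z) ` F k" for k z
    by (auto simp: a_r_coset_def')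
  \<comment> \<open>A union of equal sets has their common value only over a nonempty index
    set.\<close>
  have "F (p - 1) \<noteq> {}" "F (q - 1) \<noteq> {}"
    using F_zero by auto
  then show ?thesis
    by (simp add: rcoset_mult_def coset[of "p - 1" x] coset[of "q - 1" y] same)
qed

lemma carrier_assoc_graded:
  "carrier (assoc_graded A F) =
    {g. (\<forall>p. g p \<in> (\<lambda>x. F (p - 1) +> x) ` F p) \<and> finite {p. g p \<noteq> F (p - 1)}}"
  by (auto simp: assoc_graded_def carrier_sum_group group_gr_part carrier_gr_part one_gr_part)

lemma zero_assoc_graded: "\<zero>\<^bsub>assoc_graded A F\<^esub> = (\<lambda>p. F (p - 1))"
  by (simp add: assoc_graded_def one_gr_part fun_eq_iff)

lemma add_assoc_graded: "g \<oplus>\<^bsub>assoc_graded A F\<^esub> h = (\<lambda>p. g p <+> h p)"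
  by (simp add: assoc_graded_def mult_gr_part fun_eq_iff)

lemma one_assoc_graded:
  "\<one>\<^bsub>assoc_graded A F\<^esub> = (\<lambda>p. if p = 0 then F (- 1) +> \<one> else F (p - 1))"
  by (simp add: assoc_graded_def one_gr_part fun_eq_iff)

text \<open>The definition sums over an index set that depends on \<open>n\<close> and on both
  factors. The terms added by passing to \<open>B\<close> have a factor in a lower filtration step,
  hence are neutral, so one finite set serves every degree.\<close>

lemma mult_assoc_graded:
  assumes "\<And>p. a p \<in> F p" "\<And>p. b p \<in> F p"
    and B: "finite B" "{p. a p \<notin> F (p - 1)} \<subseteq> B"
  shows "(\<lambda>p. F (p - 1) +> a p) \<otimes>\<^bsub>assoc_graded A F\<^esub> (\<lambda>p. F (p - 1) +> b p) =
    (\<lambda>n. F (n - 1) +> (\<Oplus>i\<in>B. a i \<otimes> b (n - i)))"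
proof
  fix n
  interpret G: comm_group "gr_part A F n"
    by (rule comm_group_gr_part)
  have ab: "a i \<otimes> b (n - i) \<in> F n" for i
    using mult_F[OF assms(1)[of i] assms(2)[of "n - i"]] by simp
  have rcm: "[mod F (n - 1):] (F (i - 1) +> a i) \<Otimes> (F (n - i - 1) +> b (n - i)) =
      F (n - 1) +> (a i \<otimes> b (n - i))" for i
    using rcoset_mult_F[OF assms(1)[of i] assms(2)[of "n - i"]] by simp
  have nz: "F (p - 1) +> a p = F (p - 1) \<longleftrightarrow> a p \<in> F (p - 1)"
    "F (p - 1) +> b p = F (p - 1) \<longleftrightarrow> b p \<in> F (p - 1)" for p
    using assms F_carrier coset_zero_iff by blast+
  let ?S = "{i. a i \<notin> F (i - 1) \<and> b (n - i) \<notin> F (n - i - 1)}"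
  \<comment> \<open>If either factor lies one step lower in the filtration, then so does the
    product.\<close>
  have vanish: "F (n - 1) +> (a i \<otimes> b (n - i)) = F (n - 1)" if "i \<notin> ?S" for i
  proof -
    have "a i \<otimes> b (n - i) \<in> F (n - 1)"
      using that mult_F[of "a i" "i - 1" "b (n - i)" "n - i"] mult_F[of "a i" i "b (n - i)" "n - i - 1"] assms(1,2)
      by auto
    then show ?thesis
      by (simp add: coset_zero_iff F_carrier)
  qed
  have "((\<lambda>p. F (p - 1) +> a p) \<otimes>\<^bsub>assoc_graded A F\<^esub> (\<lambda>p. F (p - 1) +> b p)) n =
      finprod (gr_part A F n) (\<lambda>i. F (n - 1) +> (a i \<otimes> b (n - i))) ?S"
    by (simp add: assoc_graded_def one_gr_part rcm nz)
  also have "\<dots> = finprod (gr_part A F n) (\<lambda>i. F (n - 1) +> (a i \<otimes> b (n - i))) B"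
    using B ab vanish
    by (intro G.finprod_mono_neutral_cong_left) (auto simp: one_gr_part carrier_gr_part)
  also have "\<dots> = F (n - 1) +> (\<Oplus>i\<in>B. a i \<otimes> b (n - i))"
    using B ab by (intro finprod_gr_part)
  finally show "((\<lambda>p. F (p - 1) +> a p) \<otimes>\<^bsub>assoc_graded A F\<^esub> (\<lambda>p. F (p - 1) +> b p)) n =
      F (n - 1) +> (\<Oplus>i\<in>B. a i \<otimes> b (n - i))" .
qed

end


section \<open>The filtration induced on \<open>R / I\<close> and the entries of
  \<open>phi\<close>\<close>

locale graded_ring_with_ideal = graded_ring R \<G> + ideal I R
  for R :: "('a, 'm) ring_scheme" (structure) and \<G> I
begin

definition A where "A = R Quot I"
definition F where "F = quotient_filtration R \<G> I"
definition \<pi> where "\<pi> x = I +> x"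

sublocale quot: ring_hom_ring R A \<pi>
  using rcos_ring_hom_ring unfolding A_def \<pi>_def .

lemma pi_surj: "\<pi> ` carrier R = carrier A"
  by (auto simp: \<pi>_def A_def FactRing_simps)

lemma pi_zero_iff: "x \<in> carrier R \<Longrightarrow> \<pi> x = \<zero>\<^bsub>A\<^esub> \<longleftrightarrow> x \<in> I"
  using a_coset_join1[OF _ _ a_subgroup] a_coset_join2[OF _ a_subgroup]
  by (auto simp: \<pi>_def A_def FactRing_def)

lemma pi_eq_iff: "x \<in> carrier R \<Longrightarrow> y \<in> carrier R \<Longrightarrow> \<pi> x = \<pi> y \<longleftrightarrow> x \<ominus> y \<in> I"
  using pi_zero_iff[of "x \<ominus> y"] quot.S.r_right_minus_eq[of "\<pi> x" "\<pi> y"]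
  by (simp add: minus_eq quot.S.minus_eq)

text \<open>Adding an element of \<open>I\<close> does not change a class, so the summand
  \<open>I\<close> is absorbed. The lemma serves both the filtration of \<open>R / I\<close> and,
  with another ideal, the grading of a quotient.\<close>

lemma quotient_part_eq:
  assumes "S \<subseteq> carrier R"
  shows "quotient_part R I S = \<pi> ` S"
proof -
  have absorb: "\<pi> (s \<oplus> i) = \<pi> s" if "s \<in> S" "i \<in> I" for s i
    using that assms pi_zero_iff[of i] a_Hcarr by auto
  show ?thesis
    unfolding quotient_part_def \<pi>_def[symmetric]
  proof (intro equalityI subsetI)
    fix X assume "X \<in> \<pi> ` (S <+> I)"
    then obtain s i where "s \<in> S" "i \<in> I" "X = \<pi> (s \<oplus> i)"
      unfolding set_add_def' by blast
    then show "X \<in> \<pi> ` S"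
      by (simp add: absorb)
  next
    fix X assume "X \<in> \<pi> ` S"
    then obtain s where s: "s \<in> S" "X = \<pi> s"
      by blast
    have "s \<oplus> \<zero> \<in> S <+> I"
      unfolding set_add_def' using s(1) zero_closed by blast
    moreover have "X = \<pi> (s \<oplus> \<zero>)"
      using s absorb zero_closed by simp
    ultimately show "X \<in> \<pi> ` (S <+> I)"
      by blast
  qed
qed

lemma F_eq: "F p = \<pi> ` grading_filtration R \<G> p"
  unfolding F_def quotient_filtration_def
  by (rule quotient_part_eq) (auto simp: filtration_carrier)

sublocale mf: multiplicative_filtration A F
proof (intro multiplicative_filtration.intro multiplicative_filtration_axioms.intro)
  show "ring A" ..
  show "additive_subgroup (F p) A" for p
  proof (rule additive_subgroupI)
    show "subgroup (F p) (add_monoid A)"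
      unfolding F_eq
      by (rule group_hom.subgroup_img_is_subgroup[OF quot.a_group_hom additive_subgroup.a_subgroup])
        (rule filtration_subgroup)
  qed
  show "F p \<subseteq> F q" if "p \<le> q" for p q
    unfolding F_eq by (intro image_mono filtration_mono that)
  show "x \<otimes>\<^bsub>A\<^esub> y \<in> F (p + q)" if "x \<in> F p" "y \<in> F q" for x y p q
    using that filtration_mult unfolding F_eq
    by (auto simp: filtration_carrier simp flip: quot.hom_mult)
qed

lemma pi_F_iff:
  assumes "x \<in> carrier R"
  shows "\<pi> x \<in> F p \<longleftrightarrow> (\<exists>y\<in>grading_filtration R \<G> p. x \<ominus> y \<in> I)"
  unfolding F_eq using assms pi_eq_iff filtration_carrier by blast

text \<open>A representative of the coset has the form \<open>(i \<oplus> y) \<oplus> x\<close> with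
  \<open>i \<in> I\<close> and \<open>y\<close> of degree below \<open>p\<close>. Here
  \<open>\<pi>\<close> kills \<open>i\<close> and sends \<open>y\<close> into
  \<open>F (p - 1)\<close>, so the union in \<open>canonical_part_map\<close> is over equal
  cosets.\<close>

lemma phi_part_eq:
  assumes x: "x \<in> carrier R"
  shows "phi_part R \<G> I p x = F (p - 1) +>\<^bsub>A\<^esub> \<pi> x"
proof -
  let ?C = "((I \<inter> grading_filtration R \<G> p) <+> grading_filtration R \<G> (p - 1)) +> x"
  have "F (p - 1) +>\<^bsub>A\<^esub> \<pi> f = F (p - 1) +>\<^bsub>A\<^esub> \<pi> x" if "f \<in> ?C" for f
  proof -
    obtain i y where f: "f = (i \<oplus> y) \<oplus> x" and i: "i \<in> I" and y: "y \<in> grading_filtration R \<G> (p - 1)"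
      using \<open>f \<in> ?C\<close> unfolding a_r_coset_def' set_add_def' by auto
    have "\<pi> f = \<pi> y \<oplus>\<^bsub>A\<^esub> \<pi> x"
      using f i y x pi_zero_iff[of i] by (simp add: a_Hcarr filtration_carrier)
    moreover have "\<pi> y \<in> F (p - 1)"
      unfolding F_eq using y by blast
    ultimately show ?thesis
      using x by (simp add: mf.coset_shift)
  qed
  then have "(\<Union>f\<in>?C. F (p - 1) +>\<^bsub>A\<^esub> \<pi> f) = (\<Union>f\<in>?C. F (p - 1) +>\<^bsub>A\<^esub> \<pi> x)"
    by (intro SUP_cong refl)
  \<comment> \<open>Again the union collapses to the common coset only if its index set is
    inhabited.\<close>
  moreover have "?C \<noteq> {}"
  proof -
    have zero: "\<zero> \<in> grading_filtration R \<G> q" for q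
      using additive_subgroup.zero_closed[OF filtration_subgroup] .
    have "\<zero> \<oplus> \<zero> \<in> (I \<inter> grading_filtration R \<G> p) <+> grading_filtration R \<G> (p - 1)"
      unfolding set_add_def' by (auto simp: zero intro!: bexI[of _ "\<zero>"])
    then show ?thesis
      unfolding a_r_coset_def' by auto
  qed
  ultimately show ?thesis
    unfolding phi_part_def canonical_part_map_def F_def[symmetric] A_def[symmetric] \<pi>_def[symmetric]
    by simp
qed

lemma phi_eq:
  "x \<in> carrier R \<Longrightarrow> phi R \<G> I x = (\<lambda>p. F (p - 1) +>\<^bsub>A\<^esub> \<pi> (components R \<G> x p))"
  by (simp add: phi_def phi_part_eq)

lemma pi_part_F: "x \<in> \<G> p \<Longrightarrow> \<pi> x \<in> F p"
  unfolding F_eq by (intro imageI part_filtration)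

lemma phi_eq_zero_iff:
  assumes x: "x \<in> carrier R"
  shows "phi R \<G> I x p = F (p - 1) \<longleftrightarrow> \<pi> (components R \<G> x p) \<in> F (p - 1)"
  using x by (simp add: phi_eq mf.coset_zero_iff)

section \<open>\<open>phi\<close> as a graded epimorphism\<close>

lemma phi_carrier:
  assumes x: "x \<in> carrier R"
  shows "phi R \<G> I x \<in> carrier (assoc_graded A F)"
proof -
  have "{p. phi R \<G> I x p \<noteq> F (p - 1)} \<subseteq> {p. components R \<G> x p \<noteq> \<zero>}"
    using x mf.F_zero by (auto simp: phi_eq_zero_iff)
  then have "finite {p. phi R \<G> I x p \<noteq> F (p - 1)}"
    using finite_support[OF x] finite_subset by blast
  then show ?thesis
    using x by (auto simp: mf.carrier_assoc_graded phi_eq pi_part_F)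
qed

text \<open>Both products are convolutions over the support of \<open>x\<close>, by
  \<open>components_mult\<close> and \<open>mf.mult_assoc_graded\<close>, and \<open>\<pi>\<close>
  commutes with finite sums and products.\<close>

lemma phi_mult:
  assumes x: "x \<in> carrier R" and y: "y \<in> carrier R"
  shows "phi R \<G> I (x \<otimes> y) = phi R \<G> I x \<otimes>\<^bsub>assoc_graded A F\<^esub> phi R \<G> I y"
proof -
  let ?B = "{i. components R \<G> x i \<noteq> \<zero>}"
  have "{p. \<pi> (components R \<G> x p) \<notin> F (p - 1)} \<subseteq> ?B"
    using mf.F_zero by auto
  then have "phi R \<G> I x \<otimes>\<^bsub>assoc_graded A F\<^esub> phi R \<G> I y =
     (\<lambda>n. F (n - 1) +>\<^bsub>A\<^esub> (\<Oplus>\<^bsub>A\<^esub>i\<in>?B. \<pi> (components R \<G> x i) \<otimes>\<^bsub>A\<^esub> \<pi> (components R \<G> y (n - i))))"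
    unfolding phi_eq[OF x] phi_eq[OF y] using x y
    by (intro mf.mult_assoc_graded finite_support pi_part_F) auto
  also have "\<dots> = (\<lambda>n. F (n - 1) +>\<^bsub>A\<^esub> \<pi> (components R \<G> (x \<otimes> y) n))"
    using x y
    by (simp add: components_mult[OF x y finite_support[OF x] order.refl] comp_def)
  finally show ?thesis
    using x y by (simp add: phi_eq)
qed

lemma phi_hom: "phi R \<G> I \<in> ring_hom R (assoc_graded A F)"
proof (rule ring_hom_memI)
  \<comment> \<open>By \<open>one_part\<close> all components of the unit outside degree 0 vanish,
    and the class of zero is the neutral coset.\<close>
  show "phi R \<G> I \<one> = \<one>\<^bsub>assoc_graded A F\<^esub>"
    using mf.coset_zero_iff[OF quot.S.zero_closed] mf.F_zero
    by (simp add: phi_eq mf.one_assoc_graded components_homogeneous[OF one_part] fun_eq_iff)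
  show "phi R \<G> I (x \<oplus> y) = phi R \<G> I x \<oplus>\<^bsub>assoc_graded A F\<^esub> phi R \<G> I y"
    if "x \<in> carrier R" "y \<in> carrier R" for x y
    using that by (simp add: phi_eq components_add mf.add_assoc_graded mf.coset_sum)
qed (simp_all add: phi_carrier phi_mult)

text \<open>Each entry of \<open>g\<close> has a homogeneous representative of the right degree; as
  almost all entries are neutral, these representatives add up to a preimage.\<close>

lemma phi_surj: "phi R \<G> I ` carrier R = carrier (assoc_graded A F)"
proof (intro equalityI subsetI)
  fix g assume g: "g \<in> carrier (assoc_graded A F)"
  \<comment> \<open>Neutral entries receive the representative zero, so that \<open>r\<close> is
    supported in the finite set \<open>B\<close> below.\<close>
  have "\<forall>p. \<exists>r\<in>\<G> p. g p = F (p - 1) +>\<^bsub>A\<^esub> \<pi> r \<and> (g p = F (p - 1) \<longrightarrow> r = \<zero>)"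
  proof
    fix p
    have "g p \<in> (\<lambda>a. F (p - 1) +>\<^bsub>A\<^esub> a) ` F p"
      using g unfolding mf.carrier_assoc_graded by blast
    then obtain x where x: "x \<in> grading_filtration R \<G> p" "g p = F (p - 1) +>\<^bsub>A\<^esub> \<pi> x"
      unfolding F_eq[of p] by blast
    then have xc: "x \<in> carrier R"
      by (simp add: filtration_carrier)
    let ?r = "components R \<G> x p"
    have "x = (x \<ominus> ?r) \<oplus> ?r"
      using xc by (simp add: minus_eq a_assoc l_neg)
    then have "\<pi> x = \<pi> (x \<ominus> ?r) \<oplus>\<^bsub>A\<^esub> \<pi> ?r"
      using xc by (metis components_carrier minus_closed quot.hom_add)
    moreover have "\<pi> (x \<ominus> ?r) \<in> F (p - 1)"
      unfolding F_eq by (intro imageI minus_top_component x)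
    ultimately have "g p = F (p - 1) +>\<^bsub>A\<^esub> \<pi> ?r"
      using x(2) xc by (simp add: mf.coset_shift)
    moreover have "F (p - 1) +>\<^bsub>A\<^esub> \<pi> \<zero> = F (p - 1)"
      using mf.coset_zero_iff mf.F_zero by simp
    ultimately show "\<exists>r\<in>\<G> p. g p = F (p - 1) +>\<^bsub>A\<^esub> \<pi> r \<and> (g p = F (p - 1) \<longrightarrow> r = \<zero>)"
      using xc part_zero components_part by metis
  qed
  then obtain r where r: "\<And>p. r p \<in> \<G> p" "\<And>p. g p = F (p - 1) +>\<^bsub>A\<^esub> \<pi> (r p)"
    "\<And>p. g p = F (p - 1) \<Longrightarrow> r p = \<zero>"
    by metis
  define B where "B = {p. g p \<noteq> F (p - 1)}"
  have fin: "finite B"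
    using g by (simp add: B_def mf.carrier_assoc_graded)
  have "(\<Oplus>p\<in>B. r p) \<in> carrier R"
    using r(1) by (intro finsum_closed) auto
  moreover have "components R \<G> (\<Oplus>p\<in>B. r p) = r"
    by (rule components_eqI[OF fin r(1) _ refl]) (use r(3) B_def in auto)
  ultimately have "phi R \<G> I (\<Oplus>p\<in>B. r p) = g"
    using r(2) by (auto simp: phi_eq)
  then show "g \<in> phi R \<G> I ` carrier R"
    using \<open>(\<Oplus>p\<in>B. r p) \<in> carrier R\<close> by blast
qed (auto simp: phi_carrier)

lemma ring_assoc_graded: "ring (assoc_graded A F)"
proof -
  \<comment> \<open>Membership in \<open>ring_hom\<close> says nothing about zero, and the target is
    not yet known to be a ring, so this has to be checked on entries.\<close>
  have "phi R \<G> I \<zero> = \<zero>\<^bsub>assoc_graded A F\<^esub>"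
    using mf.coset_zero_iff[OF quot.S.zero_closed] mf.F_zero
    by (simp add: phi_eq mf.zero_assoc_graded components_zero)
  then show ?thesis
    using ring_hom_imp_img_ring[OF phi_hom] by (simp add: phi_surj)
qed

lemma phi_kernel_iff:
  assumes "x \<in> carrier R"
  shows "phi R \<G> I x = \<zero>\<^bsub>assoc_graded A F\<^esub> \<longleftrightarrow> (\<forall>p. \<pi> (components R \<G> x p) \<in> F (p - 1))"
  unfolding mf.zero_assoc_graded fun_eq_iff by (simp add: phi_eq_zero_iff assms)

text \<open>By \<open>phi_kernel_iff\<close> the kernel is cut out by a separate condition on each
  component, and zero components satisfy it.\<close>

lemma phi_kernel_homogeneous:
  assumes x: "x \<in> carrier R" and "phi R \<G> I x = \<zero>\<^bsub>assoc_graded A F\<^esub>"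
  shows "phi R \<G> I (components R \<G> x p) = \<zero>\<^bsub>assoc_graded A F\<^esub>"
  using assms mf.F_zero by (auto simp: phi_kernel_iff components_homogeneous[OF components_part])

text \<open>A preimage of \<open>g\<close> may be replaced by its component of degree
  \<open>p\<close>, since the other entries of \<open>g\<close> are neutral. Equality, not just
  inclusion, is what the transport lemmas on graded images require.\<close>

lemma assoc_graded_part_eq: "assoc_graded_part A F p = phi R \<G> I ` \<G> p"
proof (intro equalityI subsetI)
  fix g assume "g \<in> assoc_graded_part A F p"
  then obtain x where x: "x \<in> carrier R" "g = phi R \<G> I x" and g: "\<And>q. q \<noteq> p \<Longrightarrow> g q = F (q - 1)"
    unfolding assoc_graded_part_def mf.one_gr_part phi_surj[symmetric] by blast
  have "phi R \<G> I (components R \<G> x p) q = g q" for q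
    using x g[of q] mf.coset_zero_iff[OF quot.S.zero_closed] mf.F_zero
    by (cases "q = p") (auto simp: phi_eq components_homogeneous[OF components_part])
  then show "g \<in> phi R \<G> I ` \<G> p"
    using x by (intro image_eqI[of _ _ "components R \<G> x p"]) auto
next
  fix g assume "g \<in> phi R \<G> I ` \<G> p"
  then obtain x where x: "x \<in> \<G> p" "g = phi R \<G> I x"
    by blast
  have "g q = F (q - 1)" if "q \<noteq> p" for q
    using that x mf.F_zero by (simp add: phi_eq_zero_iff components_homogeneous)
  then show "g \<in> assoc_graded_part A F p"
    using x phi_carrier by (simp add: assoc_graded_part_def mf.one_gr_part)
qed

lemma phi_epi: "graded_ring_epi R \<G> (assoc_graded A F) (assoc_graded_part A F) (phi R \<G> I)"
  by (rule graded_ring_epi_image)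
    (simp_all add: graded_ring_axioms ring_assoc_graded phi_hom phi_surj phi_kernel_homogeneous
      assoc_graded_part_eq)

section \<open>The kernel of \<open>phi\<close> and the leading parts of \<open>I\<close>\<close>

lemma homogeneous_in_LH_iff:
  assumes x: "x \<in> \<G> p"
  shows "\<pi> x \<in> F (p - 1) \<longleftrightarrow> x \<in> LH R \<G> ` I"
proof -
  have xc: "x \<in> carrier R"
    using x by blast
  have "x \<in> LH R \<G> ` I" if "\<pi> x \<in> F (p - 1)"
  proof -
    from that obtain y where y: "y \<in> grading_filtration R \<G> (p - 1)" "x \<ominus> y \<in> I"
      using pi_F_iff xc by blast
    show ?thesis
    proof (cases "x = \<zero>")
      case True
      \<comment> \<open>Zero is a leading part of an element of \<open>I\<close> through the default
        value \<open>LH(0) = 0\<close>.\<close>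
      then show ?thesis
        by (intro image_eqI[of _ _ \<zero>]) (simp_all add: LH_def)
    next
      case False
      have yc: "y \<in> carrier R"
        using y filtration_carrier by blast
      \<comment> \<open>Only degrees from \<open>p\<close> upwards matter for the leading part, and
        \<open>y\<close> has no components there; hence the leading part of
        \<open>x \<ominus> y\<close> is \<open>x\<close>.\<close>
      have comp: "components R \<G> (x \<ominus> y) q = (if q = p then x else \<zero>)" if "q \<ge> p" for q
        using y(1) that yc xc
        by (auto simp: minus_eq components_add components_uminus components_homogeneous[OF x]
              grading_filtration_def)
      have "x \<ominus> y \<in> grading_filtration R \<G> p"
        using comp xc yc by (simp add: grading_filtration_def)
      then have "LH R \<G> (x \<ominus> y) = x"
        using LH_eqI[of "x \<ominus> y" p] comp False by simp
      then show ?thesis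
        using y(2) by force
    qed
  qed
  moreover have "\<pi> x \<in> F (p - 1)" if "x \<in> LH R \<G> ` I"
  proof -
    from that obtain f where f: "f \<in> I" "x = LH R \<G> f"
      by blast
    show ?thesis
    proof (cases "x = \<zero>")
      case True
      then show ?thesis
        using mf.F_zero by simp
    next
      case False
      have fc: "f \<in> carrier R"
        using f a_Hcarr by blast
      have "f \<noteq> \<zero>"
        using False f by (auto simp: LH_def)
      then obtain q where q: "f \<in> grading_filtration R \<G> q" "components R \<G> f q \<noteq> \<zero>"
        using top_degree[OF fc] by blast
      have xq: "x = components R \<G> f q"
        using LH_eqI[OF q] f by simp
      \<comment> \<open>\<open>x\<close> is homogeneous of degree \<open>p\<close> and, as a
        component of \<open>f\<close>, also of degree \<open>q\<close>; being nonzero, it can have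
        only one degree.\<close>
      have "q = p"
      proof (rule ccontr)
        assume "q \<noteq> p"
        then have "components R \<G> x q = \<zero>"
          using components_homogeneous[OF x] by simp
        then show False
          using components_homogeneous[of x q] xq fc q(2) by auto
      qed
      then have "f \<ominus> x \<in> grading_filtration R \<G> (p - 1)"
        using minus_top_component[OF q(1)] xq by simp
      \<comment> \<open>This element of lower degree is the witness for \<open>pi_F_iff\<close>:
        subtracting it from \<open>x\<close> leaves \<open>f\<close>, which lies in
        \<open>I\<close>.\<close>
      then have "\<ominus> (f \<ominus> x) \<in> grading_filtration R \<G> (p - 1)"
        using additive_subgroup.a_inv_closed[OF filtration_subgroup] by blast
      moreover have "x \<ominus> (\<ominus> (f \<ominus> x)) = f"
        using xc fc by (simp add: minus_eq minus_add r_neg a_comm[of f] a_assoc[symmetric])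
      ultimately show ?thesis
        using pi_F_iff[OF xc] f(1) by metis
    qed
  qed
  ultimately show ?thesis
    by blast
qed

text \<open>Both inclusions reduce to homogeneous elements: an element of the kernel is the sum of
  its components, each in \<open>LH(I)\<close>, while the generators in \<open>LH(I)\<close> are
  themselves homogeneous and the kernel is an ideal.\<close>

lemma phi_kernel: "a_kernel R (assoc_graded A F) (phi R \<G> I) = genideal R (LH R \<G> ` I)"
proof
  interpret phi: ring_hom_ring R "assoc_graded A F" "phi R \<G> I"
    by (rule ring_hom_ringI2) (use phi_hom ring_axioms ring_assoc_graded in auto)
  have LH: "LH R \<G> ` I \<subseteq> carrier R"
    using a_Hcarr LH_carrier by blast
  interpret J: ideal "genideal R (LH R \<G> ` I)" R
    by (rule genideal_ideal[OF LH])
  show "a_kernel R (assoc_graded A F) (phi R \<G> I) \<subseteq> genideal R (LH R \<G> ` I)"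
  proof
    fix x assume "x \<in> a_kernel R (assoc_graded A F) (phi R \<G> I)"
    then have x: "x \<in> carrier R" and "phi R \<G> I x = \<zero>\<^bsub>assoc_graded A F\<^esub>"
      unfolding a_kernel_def' by blast+
    then have "\<pi> (components R \<G> x p) \<in> F (p - 1)" for p
      using phi_kernel_iff by blast
    then have "components R \<G> x p \<in> LH R \<G> ` I" for p
      using homogeneous_in_LH_iff[OF components_part[OF x]] by blast
    then have *: "components R \<G> x p \<in> genideal R (LH R \<G> ` I)" for p
      using genideal_self[OF LH] by blast
    have "(\<Oplus>p\<in>B. components R \<G> x p) \<in> genideal R (LH R \<G> ` I)" if "finite B" for B
      using that
    proof (induction B rule: finite_induct)
      case (insert p B)
      then show ?case
        using x * J.a_closed by (subst finsum_insert) auto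
    qed simp
    from this[OF finite_support[OF x]] show "x \<in> genideal R (LH R \<G> ` I)"
      using finsum_components[OF x finite_support[OF x] order.refl] by simp
  qed
  show "genideal R (LH R \<G> ` I) \<subseteq> a_kernel R (assoc_graded A F) (phi R \<G> I)"
  proof (rule genideal_minimal[OF phi.kernel_is_ideal], rule subsetI)
    fix x assume x: "x \<in> LH R \<G> ` I"
    then obtain p where p: "x \<in> \<G> p"
      using a_Hcarr LH_homogeneous by blast
    then have "\<pi> x \<in> F (p - 1)"
      using x homogeneous_in_LH_iff by blast
    then have "\<pi> (components R \<G> x q) \<in> F (q - 1)" for q
      using mf.F_zero by (simp add: components_homogeneous[OF p])
    then show "x \<in> a_kernel R (assoc_graded A F) (phi R \<G> I)"
      unfolding a_kernel_def' using phi_kernel_iff part_carrier[OF p] by blast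
  qed
qed

end

section \<open>The grading of \<open>R / J\<close> and its comparison with the associated graded
  ring\<close>

theorem theorem1p6:
  fixes R :: "('a, 'm) ring_scheme" and \<G> :: "int \<Rightarrow> 'a set" and I :: "'a set"
  assumes "graded_ring R \<G>"
    and "ideal I R" and "I \<noteq> carrier R"
  defines "A \<equiv> R Quot I"
    and "F \<equiv> quotient_filtration R \<G> I"
    and "J \<equiv> genideal R (LH R \<G> ` I)"
  shows "graded_ring_epi R \<G> (assoc_graded A F) (assoc_graded_part A F) (phi R \<G> I)
       \<and> a_kernel R (assoc_graded A F) (phi R \<G> I) = J
       \<and> graded_isomorphic (assoc_graded A F) (assoc_graded_part A F)
              (R Quot J) (\<lambda>p. quotient_part R J (\<G> p))"
proof -
  interpret RI: graded_ring_with_ideal R \<G> I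
    using assms(1,2) by (rule graded_ring_with_ideal.intro)
  have A: "A = RI.A" and F: "F = RI.F"
    by (simp_all add: A_def F_def RI.A_def RI.F_def)
  \<comment> \<open>Reading \<open>J\<close> as the kernel of \<open>phi\<close> gives its
    homogeneity from \<open>RI.phi_kernel_homogeneous\<close>, which the grading of
    \<open>R / J\<close> depends on.\<close>
  have J: "J = a_kernel R (assoc_graded A F) (phi R \<G> I)"
    unfolding A F J_def RI.phi_kernel ..
  have "LH R \<G> ` I \<subseteq> carrier R"
    using RI.a_Hcarr RI.LH_carrier by blast
  then have "ideal J R"
    unfolding J_def by (rule RI.genideal_ideal)
  \<comment> \<open>The same locale with \<open>J\<close> in place of \<open>I\<close> provides the
    projection \<open>RJ.\<pi>\<close> onto \<open>R / J\<close>.\<close>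
  with assms(1) interpret RJ: graded_ring_with_ideal R \<G> J
    by (rule graded_ring_with_ideal.intro)
  have kernel_J: "a_kernel R (R Quot J) RJ.\<pi> = J"
    unfolding a_kernel_def' using RJ.pi_zero_iff[unfolded RJ.A_def] RJ.a_Hcarr by blast
  have "graded_ring_epi R \<G> (R Quot J) (\<lambda>p. quotient_part R J (\<G> p)) RJ.\<pi>"
  proof (rule graded_ring_epi_image[OF assms(1)])
    show "RJ.\<pi> (components R \<G> x p) = \<zero>\<^bsub>R Quot J\<^esub>"
      if "x \<in> carrier R" "RJ.\<pi> x = \<zero>\<^bsub>R Quot J\<^esub>" for x p
    proof -
      have "x \<in> J"
        using that RJ.pi_zero_iff by (simp add: RJ.A_def)
      then have "components R \<G> x p \<in> J"
        using RI.phi_kernel_homogeneous[of x p] that(1) unfolding J A F a_kernel_def' by blast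
      then show ?thesis
        using RJ.pi_zero_iff[of "components R \<G> x p"] that(1) by (simp add: RJ.A_def)
    qed
    show "quotient_part R J (\<G> p) = RJ.\<pi> ` \<G> p" for p
      by (rule RJ.quotient_part_eq) auto
  qed (use RJ.quot.homh RJ.pi_surj RJ.quot.S.ring_axioms in \<open>simp_all add: RJ.A_def\<close>)
  then have "graded_isomorphic (assoc_graded A F) (assoc_graded_part A F)
              (R Quot J) (\<lambda>p. quotient_part R J (\<G> p))"
    \<comment> \<open>\<open>phi\<close> and \<open>RJ.\<pi>\<close> are two graded epimorphisms out
      of \<open>R\<close> with the same kernel \<open>J\<close>.\<close>
    unfolding A F
    by (rule graded_isomorphic_if_same_kernel[OF RI.phi_epi _ RI.assoc_graded_part_eq])
      (use kernel_J J A F in simp)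
  then show ?thesis
    using RI.phi_epi J unfolding A F by simp
qed

end
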